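(* For all trees $T,T'\in\mathbb{T}$ and all $i,j\in\mathbb{N}$, there exists a bijection from $N_{i,j}(T,T')$ to $\widetilde S_{j,i}(T,T')$, where $$N_{i,j}(T,T')=\{((T,T''),(T',T''))\in G_{U_i}\times G_{D_j}\},$$ $$S_{j,i}(T,T')=\{((T'',T),(T'',T'))\in G_{D_j}\times G_{U_i}\},\qquad \widetilde S_{j,i}(T,T')=\coprod_{k=0}^{\min(i,j)}S_{j-k,i-k}(T,T')$$ ($T''$ ranging over $\mathbb{T}$, and $\coprod$ denoting disjoint union).
   Context: Trees. $\mathbb{N}=\{0,1,2,\ldots\}$. Let $F$ be the monoid of words in the alphabet $\{1,2\}$, with the empty word denoted $0$, partially ordered by $v\le vw$ for $v,w\in F$ (prefix order). A (rooted planar binary) tree is a finite order ideal of $F$, i.e. a finite, possibly empty, subset $T\subset F$ closed under taking prefixes; its elements are its nodes. $\mathbb{T}$ is the set of all trees, and $|T|$ is the number of nodes of $T$. For $v\in F$ put $T_v=\{w\in T: v\le w\}$. The graph $G_{U_i}$. $G_U$ is the set of pairs $(T,T')$ of trees with $T\subset T'$ such that: if $T\ne\emptyset$, each $w\in T'\setminus T$ can be written $w=v1^n$ or $w=v21^n$ for some $v\in T$ and some integer $n\ge 0$; if $T=\emptyset$, each $w\in T'\setminus T$ is of the form $1^n$, $n\ge 0$. $G_{U_i}=\{(T,T')\in G_U: |T|+i=|T'|\}$. The graph $G_{D_i}$. For a tree $T$ let $R_T=\{w\in T: w2\notin T\}$. For $w\in R_T$ let $T\circleddash w=(T\setminus T_w)\cup\{wv: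 w1v\in T_w\}$ (delete $w$ and move its left subtree up into its place). Let $E_T$ be the set of $w\in T$ such that whenever $w=v1w'$ with $v,w'\in F$ one has $v2\notin T$. Let $r_T=E_T\cap R_T$; it is a chain $w_{T,1}<w_{T,2}<\cdots<w_{T,k}$. For $0\le i\le |r_T|$ put $r_{T,i}=\{w_{T,1},\ldots,w_{T,i}\}$, and define $T\ominus r_{T,i}$ inductively by $T\ominus r_{T,0}=T$ and $T\ominus r_{T,i}=(T\circleddash w_{T,i})\ominus r_{T,i-1}$ for $i>0$; that is, apply $\circleddash w_{T,i}$, then $\circleddash w_{T,i-1}$, ..., finally $\circleddash w_{T,1}$. $G_{D_i}=\{(T\ominus r_{T,i},T): T\in\mathbb{T},\ |r_T|\ge i\}$. *)

theory Defs
  imports Main "HOL-Library.Sublist"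
begin

(* The letters 1 and 2; the monoid F is the type of words, the empty list being the
   word denoted 0 in the text, with the prefix order of HOL-Library.Sublist. *)
datatype letter = L1 | L2

type_synonym word = "letter list"

definition trees :: "word set set" where
  "trees = {T. finite T \<and> (\<forall>w\<in>T. \<forall>v. prefix v w \<longrightarrow> v \<in> T)}"

definition subtree_at :: "word set \<Rightarrow> word \<Rightarrow> word set" where
  "subtree_at T v = {w \<in> T. prefix v w}"

definition G_U :: "(word set \<times> word set) set" where
  "G_U = {(T, T'). T \<in> trees \<and> T' \<in> trees \<and> T \<subseteq> T' \<and>
     (if T \<noteq> {}
      then \<forall>w \<in> T' - T. \<exists>v\<in>T. \<exists>n. w = v @ replicate n L1 \<or> w = v @ [L2] @ replicate n L1
      else \<forall>w \<in> T' - T. \<exists>n. w = replicate n L1)}"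

definition G_Ui :: "nat \<Rightarrow> (word set \<times> word set) set" where
  "G_Ui i = {(T, T') \<in> G_U. card T + i = card T'}"

definition R_set :: "word set \<Rightarrow> word set" where
  "R_set T = {w \<in> T. w @ [L2] \<notin> T}"

definition cdash :: "word set \<Rightarrow> word \<Rightarrow> word set" where
  "cdash T w = (T - subtree_at T w) \<union> {w @ v | v. w @ [L1] @ v \<in> subtree_at T w}"

definition E_set :: "word set \<Rightarrow> word set" where
  "E_set T = {w \<in> T. \<forall>v w'. w = v @ [L1] @ w' \<longrightarrow> v @ [L2] \<notin> T}"

definition r_set :: "word set \<Rightarrow> word set" where
  "r_set T = E_set T \<inter> R_set T"

(* The k-th smallest element (1 \<le> k \<le> card (r_set T)) of the chain r_set T: the element
   with exactly k elements of the chain below or equal to it.  See r_node_props. *)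
definition r_node :: "word set \<Rightarrow> nat \<Rightarrow> word" where
  "r_node T k = (THE w. w \<in> r_set T \<and> card {v \<in> r_set T. prefix v w} = k)"

(* With i nodes w_1, ..., w_i of T fixed in advance, apply cdash at w_i, then at w_(i-1),
   and so on.  The nodes are always those of the original tree T, not of the intermediate
   trees, which is why the current tree S is a separate argument. *)
primrec ominus_from :: "word set \<Rightarrow> word set \<Rightarrow> nat \<Rightarrow> word set" where
  "ominus_from T S 0 = S"
| "ominus_from T S (Suc i) = ominus_from T (cdash S (r_node T (Suc i))) i"

definition ominus_r :: "word set \<Rightarrow> nat \<Rightarrow> word set" where
  "ominus_r T i = ominus_from T T i"

definition G_Di :: "nat \<Rightarrow> (word set \<times> word set) set" where
  "G_Di i = {(ominus_r T i, T) | T. T \<in> trees \<and> i \<le> card (r_set T)}"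

type_synonym edge = "word set \<times> word set"

definition N_set :: "nat \<Rightarrow> nat \<Rightarrow> word set \<Rightarrow> word set \<Rightarrow> (edge \<times> edge) set" where
  "N_set i j T T' =
     {((T, T''), (T', T'')) | T''. T'' \<in> trees \<and> ((T, T''), (T', T'')) \<in> G_Ui i \<times> G_Di j}"

definition S_set :: "nat \<Rightarrow> nat \<Rightarrow> word set \<Rightarrow> word set \<Rightarrow> (edge \<times> edge) set" where
  "S_set j i T T' =
     {((T'', T), (T'', T')) | T''. T'' \<in> trees \<and> ((T'', T), (T'', T')) \<in> G_Di j \<times> G_Ui i}"

definition S_tilde :: "nat \<Rightarrow> nat \<Rightarrow> word set \<Rightarrow> word set \<Rightarrow> (nat \<times> edge \<times> edge) set" where
  "S_tilde j i T T' = (SIGMA k : {0..min i j}. S_set (j - k) (i - k) T T')"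

lemma r_set_chain:
  assumes "T \<in> trees" "v \<in> r_set T" "w \<in> r_set T"
  shows "prefix v w \<or> prefix w v"
proof (rule ccontr)
  assume "\<not> ?thesis"
  then have "v \<parallel> w" by auto
  then obtain u b bs c cs where bc: "b \<noteq> c" "v = u @ b # bs" "w = u @ c # cs"
    using parallel_decomp by blast
  have closed: "\<And>x y. x \<in> T \<Longrightarrow> prefix y x \<Longrightarrow> y \<in> T" using assms(1) by (auto simp: trees_def)
  have "v \<in> T" "w \<in> T" using assms(2,3) by (auto simp: r_set_def R_set_def)
  then have "u @ [b] \<in> T" "u @ [c] \<in> T" using closed bc by (auto simp: prefix_def)
  moreover have "b = L1 \<Longrightarrow> u @ [L2] \<notin> T" "c = L1 \<Longrightarrow> u @ [L2] \<notin> T"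
    using assms(2,3) bc by (auto simp: r_set_def E_set_def)
  ultimately show False using bc(1) by (cases b; cases c) auto
qed

lemma r_node_props:
  assumes T: "T \<in> trees" and k: "1 \<le> k" "k \<le> card (r_set T)"
  shows "r_node T k \<in> r_set T" "card {v \<in> r_set T. prefix v (r_node T k)} = k"
proof -
  let ?c = "\<lambda>w. card {v \<in> r_set T. prefix v w}"
  have fin: "finite (r_set T)"
    using T by (auto simp: trees_def r_set_def R_set_def)
  have less: "?c v < ?c w" if "v \<in> r_set T" "w \<in> r_set T" "prefix v w" "v \<noteq> w" for v w
  proof (rule psubset_card_mono)
    show "finite {x \<in> r_set T. prefix x w}" using fin by simp
    have "w \<notin> {x \<in> r_set T. prefix x v}"
      using that(3,4) by (auto dest: prefix_order.antisym)
    moreover have "w \<in> {x \<in> r_set T. prefix x w}" using that(2) by simp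
    moreover have "{x \<in> r_set T. prefix x v} \<subseteq> {x \<in> r_set T. prefix x w}"
      using that(3) by (auto intro: prefix_order.trans)
    ultimately show "{x \<in> r_set T. prefix x v} \<subset> {x \<in> r_set T. prefix x w}" by blast
  qed
  have inj: "inj_on ?c (r_set T)"
  proof (rule inj_onI)
    fix v w assume "v \<in> r_set T" "w \<in> r_set T" "?c v = ?c w"
    then show "v = w" using less[of v w] less[of w v] r_set_chain[OF T, of v w] by fastforce
  qed
  have "?c ` r_set T \<subseteq> {1..card (r_set T)}"
  proof
    fix n assume "n \<in> ?c ` r_set T"
    then obtain w where w: "w \<in> r_set T" "n = ?c w" by blast
    have "{w} \<subseteq> {v \<in> r_set T. prefix v w}" using w by simp
    then have "1 \<le> n" using card_mono[of "{v \<in> r_set T. prefix v w}" "{w}"] fin w by simp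
    moreover have "n \<le> card (r_set T)" using w fin by (auto intro: card_mono)
    ultimately show "n \<in> {1..card (r_set T)}" by simp
  qed
  then have img: "?c ` r_set T = {1..card (r_set T)}"
    using card_image[OF inj] by (intro card_subset_eq) auto
  have "k \<in> ?c ` r_set T" unfolding img using k by simp
  then obtain w where w: "w \<in> r_set T" "?c w = k" by (elim imageE) simp
  have "\<exists>!w. w \<in> r_set T \<and> ?c w = k"
  proof (rule ex1I)
    show "w \<in> r_set T \<and> ?c w = k" using w by (intro conjI)
  next
    fix u assume u: "u \<in> r_set T \<and> ?c u = k"
    show "u = w" by (rule inj_onD[OF inj]) (use u w in simp_all)
  qed
  from theI'[OF this] have "r_node T k \<in> r_set T \<and> ?c (r_node T k) = k"
    unfolding r_node_def .
  then show "r_node T k \<in> r_set T" "?c (r_node T k) = k"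
    by (rule conjunct1, rule conjunct2)
qed

end

(* Encode a nonempty tree as graft A B, with A and B the subtrees of the root.  An edge of
   G_U out of a tree attaches a chain of left nodes (a comb) at each vacant position, so G_U is
   compatible with graft; an edge of G_D into graft A B acts on B alone unless B is empty, in
   which case it either is trivial or deletes the root and continues with A.  Writing U and D for
   the generating series of the two families in variables y and x, these recursions give
   D U = U D / (1 - x y) by induction on the tree.  Sizes determine i from j, T and T',
   so it suffices to keep track of j. *)
theory Submission
  imports Defs
begin

section \<open>Trees as grafts of the two subtrees of the root\<close>

definition graft :: "word set \<Rightarrow> word set \<Rightarrow> word set" where
  "graft A B = insert [] ((#) L1 ` A \<union> (#) L2 ` B)"

lemma mem_graft [simp]:
  "[] \<in> graft A B"
  "L1 # w \<in> graft A B \<longleftrightarrow> w \<in> A"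
  "L2 # w \<in> graft A B \<longleftrightarrow> w \<in> B"
  by (auto simp: graft_def)

lemma word_cases:
  obtains "w = []" | v where "w = L1 # v" | v where "w = L2 # v"
proof (cases w)
  case (Cons c v)
  then show ?thesis using that by (cases c) auto
qed (use that in auto)

text \<open>Sorting words by their first letter reduces inclusions of word sets to exactly the
  memberships that \<open>mem_graft\<close> decides.\<close>

lemma word_set_subset_iff:
  "X \<subseteq> Y \<longleftrightarrow> ([] \<in> X \<longrightarrow> [] \<in> Y) \<and> (\<forall>w. L1 # w \<in> X \<longrightarrow> L1 # w \<in> Y) \<and>
    (\<forall>w. L2 # w \<in> X \<longrightarrow> L2 # w \<in> Y)"
proof (intro iffI subsetI)
  fix w assume "([] \<in> X \<longrightarrow> [] \<in> Y) \<and> (\<forall>w. L1 # w \<in> X \<longrightarrow> L1 # w \<in> Y) \<and>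
    (\<forall>w. L2 # w \<in> X \<longrightarrow> L2 # w \<in> Y)" "w \<in> X"
  then show "w \<in> Y" by (cases w rule: word_cases) auto
qed blast

lemma word_set_eq_iff:
  "X = Y \<longleftrightarrow> ([] \<in> X \<longleftrightarrow> [] \<in> Y) \<and> (\<forall>w. L1 # w \<in> X \<longleftrightarrow> L1 # w \<in> Y) \<and>
    (\<forall>w. L2 # w \<in> X \<longleftrightarrow> L2 # w \<in> Y)"
  unfolding set_eq_subset word_set_subset_iff by blast

lemma graft_subset_graft [simp]: "graft A B \<subseteq> graft C D \<longleftrightarrow> A \<subseteq> C \<and> B \<subseteq> D"
  by (subst word_set_subset_iff) auto

lemma graft_inject [simp]: "graft A B = graft C D \<longleftrightarrow> A = C \<and> B = D"
  unfolding set_eq_subset by auto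

lemma graft_not_empty [simp]: "graft A B \<noteq> {}" "{} \<noteq> graft A B"
  by (auto simp: graft_def)

lemma card_graft: "finite A \<Longrightarrow> finite B \<Longrightarrow> card (graft A B) = Suc (card A + card B)"
  unfolding graft_def
  by (subst card_insert_disjoint, simp, blast, subst card_Un_disjoint) (auto simp: card_image)

lemma empty_in_trees [simp]: "{} \<in> trees"
  by (simp add: trees_def)

lemma finite_tree: "T \<in> trees \<Longrightarrow> finite T"
  by (simp add: trees_def)

lemma tree_nonempty_root: "T \<in> trees \<Longrightarrow> T \<noteq> {} \<Longrightarrow> [] \<in> T"
  by (auto simp: trees_def)

text \<open>The prefixes of \<open>c # u\<close> are the empty word and the words
  \<open>c # p\<close> with \<open>p\<close> a prefix of \<open>u\<close>, so closure under prefixes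
  can be tested on each side separately. The forward direction makes the parts found in
  \<open>tree_cases\<close> trees.\<close>

lemma graft_in_trees [simp]: "graft A B \<in> trees \<longleftrightarrow> A \<in> trees \<and> B \<in> trees"
proof -
  have "(\<forall>w\<in>graft A B. \<forall>v. prefix v w \<longrightarrow> v \<in> graft A B) \<longleftrightarrow>
      (\<forall>w\<in>A. \<forall>v. prefix v w \<longrightarrow> v \<in> A) \<and> (\<forall>w\<in>B. \<forall>v. prefix v w \<longrightarrow> v \<in> B)"
    (is "?L \<longleftrightarrow> ?R")
  proof
    assume L: ?L
    show ?R
    proof (intro conjI ballI allI impI)
      fix w v assume "w \<in> A" "prefix v w"
      then show "v \<in> A" using L[rule_format, of "L1 # w" "L1 # v"] by simp
    next
      fix w v assume "w \<in> B" "prefix v w"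
      then show "v \<in> B" using L[rule_format, of "L2 # w" "L2 # v"] by simp
    qed
  next
    assume R: ?R
    show ?L
    proof (intro ballI allI impI)
      fix w v assume w: "w \<in> graft A B" "prefix v w"
      show "v \<in> graft A B"
      proof (cases w rule: word_cases)
        case (2 u)
        then show ?thesis using w R[THEN conjunct1, rule_format, of u]
          by (cases v) auto
      next
        case (3 u)
        then show ?thesis using w R[THEN conjunct2, rule_format, of u]
          by (cases v) auto
      qed (use w in simp)
    qed
  qed
  moreover have "finite (graft A B) \<longleftrightarrow> finite A \<and> finite B"
    by (simp add: graft_def finite_image_iff)
  ultimately show ?thesis unfolding trees_def mem_Collect_eq by argo
qed

lemma tree_cases:
  assumes "T \<in> trees"
  obtains "T = {}" | A B where "A \<in> trees" "B \<in> trees" "T = graft A B"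
proof (cases "T = {}")
  case False
  then have "[] \<in> T" using assms by (simp add: tree_nonempty_root)
  then have eq: "T = graft {w. L1 # w \<in> T} {w. L2 # w \<in> T}"
    by (subst word_set_eq_iff) auto
  moreover have "{w. L1 # w \<in> T} \<in> trees" "{w. L2 # w \<in> T} \<in> trees"
    using assms by (subst (asm) eq, simp)+
  ultimately show ?thesis using that by blast
qed (use that in auto)

lemma trees_induct [consumes 1, case_names empty graft]:
  assumes "T \<in> trees" "P {}"
    and "\<And>A B. A \<in> trees \<Longrightarrow> B \<in> trees \<Longrightarrow> P A \<Longrightarrow> P B \<Longrightarrow> P (graft A B)"
  shows "P T"
  using assms(1)
proof (induction "card T" arbitrary: T rule: less_induct)
  case less
  from less.prems show ?case
  proof (cases rule: tree_cases)
    case (2 A B)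
    then have "card A < card T" "card B < card T" by (auto simp: card_graft finite_tree)
    with 2 less.hyps show ?thesis using assms(3) by auto
  qed (use assms(2) in simp)
qed

subsection \<open>Adding combs\<close>

text \<open>The union of all combs that one edge of \<open>G_U\<close> may attach to
  \<open>T\<close>. The seed \<open>[]\<close> covers the empty tree, so no case distinction on
  \<open>T\<close> is required.\<close>

definition grow :: "word set \<Rightarrow> word set" where
  "grow T = {v @ replicate n L1 | v n. v \<in> insert [] (T \<union> (\<lambda>u. u @ [L2]) ` T)}"

lemma grow_empty: "grow {} = {replicate n L1 | n. True}"
  by (auto simp: grow_def)

lemma growI:
  "replicate n L1 \<in> grow T"
  "u \<in> T \<Longrightarrow> u @ replicate n L1 \<in> grow T"
  "u \<in> T \<Longrightarrow> u @ L2 # replicate n L1 \<in> grow T"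
proof -
  have step: "v \<in> insert [] (T \<union> (\<lambda>u. u @ [L2]) ` T) \<Longrightarrow> v @ replicate n L1 \<in> grow T" for v
    unfolding grow_def by blast
  show "replicate n L1 \<in> grow T" using step[of "[]"] by simp
  show "u \<in> T \<Longrightarrow> u @ replicate n L1 \<in> grow T" using step[of u] by simp
  show "u \<in> T \<Longrightarrow> u @ L2 # replicate n L1 \<in> grow T" using step[of "u @ [L2]"] by simp
qed

lemma growE:
  assumes "w \<in> grow T"
  obtains n where "w = replicate n L1"
  | u n where "u \<in> T" "w = u @ replicate n L1"
  | u n where "u \<in> T" "w = u @ L2 # replicate n L1"
  using assms unfolding grow_def by auto

lemma subset_grow: "T \<subseteq> grow T"
  using growI(2)[of _ T 0] by auto

text \<open>The left comb at the root of the graft continues as the comb at the root of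
  \<open>A\<close>, and the comb starting at the right child of the root is the comb at the root of
  \<open>B\<close>. Here \<open>graft\<close> is applied to infinite sets, which are not
  trees.\<close>

lemma grow_graft: "grow (graft A B) = graft (grow A) (grow B)"
proof (subst word_set_eq_iff, intro conjI allI)
  show "([] \<in> grow (graft A B)) = ([] \<in> graft (grow A) (grow B))"
    using growI(1)[of 0 "graft A B"] by simp
next
  fix w
  show "(L1 # w \<in> grow (graft A B)) = (L1 # w \<in> graft (grow A) (grow B))"
  proof
    assume "L1 # w \<in> grow (graft A B)"
    then show "L1 # w \<in> graft (grow A) (grow B)"
    proof (cases rule: growE)
      case (1 n)
      then show ?thesis by (cases n) (auto intro: growI)
    next
      case (2 u n)
      then show ?thesis by (cases u rule: word_cases, cases n) (auto intro: growI)
    next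
      case (3 u n)
      then show ?thesis by (cases u rule: word_cases) (auto intro: growI)
    qed
  next
    assume "L1 # w \<in> graft (grow A) (grow B)"
    then have "w \<in> grow A" by simp
    then show "L1 # w \<in> grow (graft A B)"
    proof (cases rule: growE)
      case (1 n)
      then show ?thesis using growI(1)[of "Suc n"] by simp
    next
      case (2 u n)
      then show ?thesis using growI(2)[of "L1 # u" "graft A B" n] by simp
    next
      case (3 u n)
      then show ?thesis using growI(3)[of "L1 # u" "graft A B" n] by simp
    qed
  qed
next
  fix w
  show "(L2 # w \<in> grow (graft A B)) = (L2 # w \<in> graft (grow A) (grow B))"
  proof
    assume "L2 # w \<in> grow (graft A B)"
    then show "L2 # w \<in> graft (grow A) (grow B)"
    proof (cases rule: growE)
      case (1 n)
      then show ?thesis by (cases n) auto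
    next
      case (2 u n)
      then show ?thesis by (cases u rule: word_cases, cases n) (auto intro: growI)
    next
      case (3 u n)
      then show ?thesis by (cases u rule: word_cases) (auto intro: growI)
    qed
  next
    assume "L2 # w \<in> graft (grow A) (grow B)"
    then have "w \<in> grow B" by simp
    then show "L2 # w \<in> grow (graft A B)"
    proof (cases rule: growE)
      case (1 n)
      then show ?thesis using growI(3)[of "[]" "graft A B" n] by simp
    next
      case (2 u n)
      then show ?thesis using growI(2)[of "L2 # u" "graft A B" n] by simp
    next
      case (3 u n)
      then show ?thesis using growI(3)[of "L2 # u" "graft A B" n] by simp
    qed
  qed
qed

text \<open>Words of \<open>T\<close> lie in \<open>grow T\<close> with a comb of length 0, so the
  condition on \<open>S - T\<close> becomes an inclusion for all of \<open>S\<close>.\<close>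

lemma G_U_iff: "(T, S) \<in> G_U \<longleftrightarrow> T \<in> trees \<and> S \<in> trees \<and> T \<subseteq> S \<and> S \<subseteq> grow T"
proof (cases "T = {}")
  case True
  then show ?thesis by (auto simp: G_U_def grow_empty)
next
  case False
  \<comment> \<open>A comb starting at the seed \<open>[]\<close> thus starts at a node of
    \<open>T\<close>.\<close>
  have "[] \<in> T" if "T \<in> trees"
    using that False by (rule tree_nonempty_root)
  then have "(\<exists>v\<in>T. \<exists>n. w = v @ replicate n L1 \<or> w = v @ [L2] @ replicate n L1) \<longleftrightarrow> w \<in> grow T"
    if "T \<in> trees" for w
    using that by (auto 4 4 intro: growI elim!: growE)
  then show ?thesis using False subset_grow[of T] unfolding G_U_def by auto blast
qed

lemma G_U_trees: "(T, S) \<in> G_U \<Longrightarrow> T \<in> trees \<and> S \<in> trees"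
  by (simp add: G_U_iff)

lemma G_U_graft_graft [simp]:
  "(graft A B, graft C D) \<in> G_U \<longleftrightarrow> (A, C) \<in> G_U \<and> (B, D) \<in> G_U"
  by (auto simp: G_U_iff grow_graft)

lemma G_U_graft_empty [simp]: "(graft A B, {}) \<notin> G_U"
  by (simp add: G_U_iff)

lemma G_U_graft_iff:
  "(graft A B, S) \<in> G_U \<longleftrightarrow> (\<exists>C D. S = graft C D \<and> (A, C) \<in> G_U \<and> (B, D) \<in> G_U)"
proof
  assume S: "(graft A B, S) \<in> G_U"
  then have "S \<in> trees" by (simp add: G_U_trees)
  then show "\<exists>C D. S = graft C D \<and> (A, C) \<in> G_U \<and> (B, D) \<in> G_U"
    by (cases rule: tree_cases) (use S in auto)
qed auto

lemma G_U_empty_right: "(T, {}) \<in> G_U \<longleftrightarrow> T = {}"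
  by (auto simp: G_U_iff)

text \<open>The chain of words consisting of fewer than \<open>n\<close> letters 1, written with
  \<open>graft\<close> so that the recursions below apply to it.\<close>

primrec comb :: "nat \<Rightarrow> word set" where
  "comb 0 = {}"
| "comb (Suc n) = graft (comb n) {}"

lemma comb_in_trees [simp]: "comb n \<in> trees"
  by (induction n) auto

lemma grow_empty_graft: "graft A B \<subseteq> grow {} \<longleftrightarrow> A \<subseteq> grow {} \<and> B = {}"
proof -
  have "[] \<in> grow {}" using growI(1)[of 0] by simp
  moreover have "L1 # w \<in> grow {} \<longleftrightarrow> w \<in> grow {}" for w
    unfolding grow_empty by (auto simp: Cons_replicate_eq)
  moreover have "L2 # w \<notin> grow {}" for w
    unfolding grow_empty by (auto simp: Cons_replicate_eq)
  ultimately show ?thesis by (subst word_set_subset_iff) auto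
qed

text \<open>No word of \<open>grow {}\<close> contains the letter 2, so by induction on
  \<open>S\<close> every right subtree is empty.\<close>

lemma G_U_empty_iff: "({}, S) \<in> G_U \<longleftrightarrow> (\<exists>n. S = comb n)"
proof -
  have "S \<subseteq> grow {} \<Longrightarrow> \<exists>n. S = comb n" if "S \<in> trees"
    using that
  proof (induction rule: trees_induct)
    case empty
    show ?case by (metis comb.simps(1))
  next
    case (graft A B)
    then show ?case by (metis grow_empty_graft comb.simps(2))
  qed
  moreover have "comb n \<subseteq> grow {}" for n
    by (induction n) (auto simp: grow_empty_graft)
  ultimately show ?thesis by (auto simp: G_U_iff)
qed

subsection \<open>Deleting nodes of the chain\<close>

lemma r_set_iff:
  "w \<in> r_set T \<longleftrightarrow> w \<in> T \<and> w @ [L2] \<notin> T \<and> (\<forall>v. (\<exists>w'. w = v @ L1 # w') \<longrightarrow> v @ [L2] \<notin> T)"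
  by (auto simp: r_set_def E_set_def R_set_def)

text \<open>In a factorisation of \<open>c # w\<close>, either \<open>v\<close> is empty or it
  begins with \<open>c\<close>. This strips one letter from the condition in
  \<open>r_set_iff\<close>.\<close>

lemma all_Cons_eq_append:
  "(\<forall>v. (\<exists>w'. c # w = v @ L1 # w') \<longrightarrow> P v) \<longleftrightarrow>
    (c = L1 \<longrightarrow> P []) \<and> (\<forall>v. (\<exists>w'. w = v @ L1 # w') \<longrightarrow> P (c # v))"
  by (auto simp: Cons_eq_append_conv)

lemma r_set_empty: "r_set {} = {}"
  by (auto simp: r_set_iff)

lemma r_set_graft_empty: "r_set (graft A {}) = insert [] ((#) L1 ` r_set A)"
proof -
  have "w \<in> r_set (graft A {}) \<longleftrightarrow> w \<in> insert [] ((#) L1 ` r_set A)" for w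
    by (cases w rule: word_cases) (simp_all add: r_set_iff all_Cons_eq_append image_iff)
  then show ?thesis by blast
qed

text \<open>The root has a right child: this removes the root from \<open>R_set\<close> and every
  node to its left from \<open>E_set\<close>.\<close>

lemma r_set_graft:
  assumes "B \<in> trees" "B \<noteq> {}"
  shows "r_set (graft A B) = (#) L2 ` r_set B"
proof -
  have "[] \<in> B" using assms by (rule tree_nonempty_root)
  then have "w \<in> r_set (graft A B) \<longleftrightarrow> w \<in> (#) L2 ` r_set B" for w
    by (cases w rule: word_cases) (simp_all add: r_set_iff all_Cons_eq_append image_iff)
  then show ?thesis by blast
qed

lemma finite_r_set: "T \<in> trees \<Longrightarrow> finite (r_set T)"
  by (auto simp: r_set_def R_set_def dest: finite_tree)

lemma card_r_set_graft_empty: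
  "A \<in> trees \<Longrightarrow> card (r_set (graft A {})) = Suc (card (r_set A))"
  by (simp add: r_set_graft_empty finite_r_set card_image card_insert_if image_iff)

lemma card_r_set_graft:
  "B \<in> trees \<Longrightarrow> B \<noteq> {} \<Longrightarrow> card (r_set (graft A B)) = card (r_set B)"
  by (simp add: r_set_graft card_image)

text \<open>Comparable chain elements of equal rank have the same elements below them, hence are
  equal. This identifies \<open>r_node\<close> by exhibiting a node of the right rank.\<close>

lemma r_node_eqI:
  assumes T: "T \<in> trees" and w: "w \<in> r_set T" "card {v \<in> r_set T. prefix v w} = k"
  shows "r_node T k = w"
proof -
  have aux: "u = v" if "u \<in> r_set T" "v \<in> r_set T" "prefix u v"
    "card {x \<in> r_set T. prefix x u} = card {x \<in> r_set T. prefix x v}" for u v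
  proof -
    have "{x \<in> r_set T. prefix x u} = {x \<in> r_set T. prefix x v}"
      using that finite_r_set[OF T] by (intro card_subset_eq) (auto intro: prefix_order.trans)
    then show "u = v" using that by (auto intro: prefix_order.antisym)
  qed
  show ?thesis
    unfolding r_node_def
  proof (rule the_equality)
    fix u assume "u \<in> r_set T \<and> card {v \<in> r_set T. prefix v u} = k"
    then show "u = w" using r_set_chain[OF T, of u w] w aux[of u w] aux[of w u] by auto
  qed (use w in blast)
qed

lemma r_node_graft:
  assumes "A \<in> trees" "B \<in> trees" "B \<noteq> {}" "1 \<le> k" "k \<le> card (r_set B)"
  shows "r_node (graft A B) k = L2 # r_node B k"
proof (rule r_node_eqI)
  note p = r_node_props[OF assms(2,4,5)]
  show "L2 # r_node B k \<in> r_set (graft A B)"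
    using p by (simp add: r_set_graft assms)
  have "{v \<in> r_set (graft A B). prefix v (L2 # r_node B k)} =
      (#) L2 ` {v \<in> r_set B. prefix v (r_node B k)}"
    by (auto simp: r_set_graft assms)
  then show "card {v \<in> r_set (graft A B). prefix v (L2 # r_node B k)} = k"
    using p by (simp add: card_image)
qed (use assms in auto)

lemma r_node_graft_empty_one:
  assumes "A \<in> trees"
  shows "r_node (graft A {}) (Suc 0) = []"
proof (rule r_node_eqI)
  have "{v \<in> r_set (graft A {}). prefix v []} = {[]}"
    by (auto simp: r_set_graft_empty)
  then show "card {v \<in> r_set (graft A {}). prefix v []} = Suc 0" by simp
qed (use assms in \<open>auto simp: r_set_graft_empty\<close>)

text \<open>The root is a new least element of the chain and raises every rank by one.\<close>

lemma r_node_graft_empty_Suc: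
  assumes "A \<in> trees" "1 \<le> k" "k \<le> card (r_set A)"
  shows "r_node (graft A {}) (Suc k) = L1 # r_node A k"
proof (rule r_node_eqI)
  note p = r_node_props[OF assms]
  show "L1 # r_node A k \<in> r_set (graft A {})"
    using p by (simp add: r_set_graft_empty)
  have "{v \<in> r_set (graft A {}). prefix v (L1 # r_node A k)} =
      insert [] ((#) L1 ` {v \<in> r_set A. prefix v (r_node A k)})"
    by (auto simp: r_set_graft_empty)
  then show "card {v \<in> r_set (graft A {}). prefix v (L1 # r_node A k)} = Suc k"
    using p finite_r_set[OF assms(1)] by (simp add: card_image card_insert_if image_iff)
qed (use assms in auto)

section \<open>Recursions for the deletion edges\<close>

lemma mem_cdash_iff:
  "x \<in> cdash T w \<longleftrightarrow> x \<in> T \<and> \<not> prefix w x \<or> (\<exists>v. x = w @ v \<and> w @ L1 # v \<in> T)"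
  by (auto simp: cdash_def subtree_at_def)

lemma cdash_graft:
  "cdash (graft A B) [] = A"
  "cdash (graft A B) (L1 # w) = graft (cdash A w) B"
  "cdash (graft A B) (L2 # w) = graft A (cdash B w)"
  by (auto simp: mem_cdash_iff set_eq_iff) (auto simp: word_set_eq_iff mem_cdash_iff graft_def)

text \<open>All deleted nodes begin with 2. The current set \<open>S\<close> is arbitrary because it
  changes during the induction while the nodes stay those of the original tree.\<close>

lemma ominus_from_graft:
  assumes "A \<in> trees" "B \<in> trees" "B \<noteq> {}" "j \<le> card (r_set B)"
  shows "ominus_from (graft A B) (graft A S) j = graft A (ominus_from B S j)"
  using assms(4)
  by (induction j arbitrary: S) (simp_all add: r_node_graft assms cdash_graft)

text \<open>Deletion proceeds from high rank to low: the first \<open>j\<close> nodes lie in the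
  left subtree, and the last one is the root, whose removal leaves the left subtree.\<close>

lemma ominus_from_graft_empty:
  assumes "A \<in> trees" "j \<le> card (r_set A)"
  shows "ominus_from (graft A {}) (graft S {}) (Suc j) = ominus_from A S j"
  using assms(2)
proof (induction j arbitrary: S)
  case 0
  then show ?case by (simp add: r_node_graft_empty_one assms cdash_graft)
next
  case (Suc j)
  then show ?case
    using r_node_graft_empty_Suc[of A "Suc j"] assms(1)
    by (simp add: cdash_graft del: ominus_from.simps(2)) (simp add: cdash_graft)
qed

lemma G_Di_iff:
  "(S, T) \<in> G_Di j \<longleftrightarrow> T \<in> trees \<and> j \<le> card (r_set T) \<and> S = ominus_r T j"
  by (auto simp: G_Di_def)

lemma G_Di_0: "(S, T) \<in> G_Di 0 \<longleftrightarrow> T \<in> trees \<and> S = T"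
  by (simp add: G_Di_iff ominus_r_def)

lemma G_Di_empty: "(S, {}) \<in> G_Di j \<longleftrightarrow> j = 0 \<and> S = {}"
  by (auto simp: G_Di_iff ominus_r_def r_set_empty)

lemma G_Di_graft_empty: "(S, graft A {}) \<in> G_Di (Suc j) \<longleftrightarrow> (S, A) \<in> G_Di j"
  by (auto simp: G_Di_iff ominus_r_def card_r_set_graft_empty ominus_from_graft_empty
      simp del: ominus_from.simps)

lemma G_Di_graft:
  "B \<noteq> {} \<Longrightarrow> (S, graft A B) \<in> G_Di j \<longleftrightarrow> A \<in> trees \<and> (\<exists>C. S = graft A C \<and> (C, B) \<in> G_Di j)"
  by (simp add: G_Di_iff ominus_r_def card_r_set_graft ominus_from_graft cong: conj_cong) auto

lemma G_Di_comb: "(S, comb n) \<in> G_Di j \<longleftrightarrow> j \<le> n \<and> S = comb (n - j)"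
proof (induction n arbitrary: j)
  case 0
  then show ?case by (auto simp: G_Di_empty)
next
  case (Suc n)
  then show ?case by (cases j) (auto simp: G_Di_0 G_Di_graft_empty)
qed

text \<open>Follows from the recursions by induction on the tree. Both \<open>S\<close> and
  \<open>j\<close> are generalised, since deleting the root passes from \<open>Suc j\<close> to
  \<open>j\<close>.\<close>

lemma G_Di_tree_card: "(S, T) \<in> G_Di j \<Longrightarrow> S \<in> trees \<and> card S + j = card T"
proof -
  have "\<forall>S j. (S, T) \<in> G_Di j \<longrightarrow> S \<in> trees \<and> card S + j = card T" if "T \<in> trees"
    using that
  proof (induction rule: trees_induct)
    case empty
    then show ?case by (auto simp: G_Di_empty)
  next
    case (graft A B)
    show ?case
    proof (intro allI impI)
      fix S j assume S: "(S, graft A B) \<in> G_Di j"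
      show "S \<in> trees \<and> card S + j = card (graft A B)"
      proof (cases "B = {}")
        case True
        then show ?thesis using S graft
          by (cases j) (auto simp: G_Di_0 G_Di_graft_empty card_graft finite_tree)
      next
        case False
        then show ?thesis using S graft
          by (auto simp: G_Di_graft card_graft finite_tree)
      qed
    qed
  qed
  then show "(S, T) \<in> G_Di j \<Longrightarrow> S \<in> trees \<and> card S + j = card T"
    by (auto simp: G_Di_iff)
qed

lemma G_Di_unique: "(S, T) \<in> G_Di j \<Longrightarrow> (S', T) \<in> G_Di j \<Longrightarrow> S = S'"
  by (simp add: G_Di_iff)

subsection \<open>Commutation\<close>

text \<open>The middle trees of \<open>N_set\<close> with the size condition on the upward edge
  dropped.\<close>

definition up_down :: "nat \<Rightarrow> word set \<Rightarrow> word set \<Rightarrow> word set set" where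
  "up_down j T T' = {S. (T, S) \<in> G_U \<and> (T', S) \<in> G_Di j}"

text \<open>Recording \<open>k\<close> suffices because \<open>T\<close> and \<open>k\<close>
  determine \<open>S\<close> (\<open>G_Di_unique\<close>). Here \<open>k\<close> counts the
  deletions performed, so it corresponds to \<open>j - k\<close> in \<open>S_tilde\<close>.\<close>

definition down_up :: "nat \<Rightarrow> word set \<Rightarrow> word set \<Rightarrow> nat set" where
  "down_up j T T' = {k. k \<le> j \<and> (\<exists>S. (S, T) \<in> G_Di k \<and> (S, T') \<in> G_U)}"

lemma finite_down_up: "finite (down_up j T T')"
  by (simp add: down_up_def)

lemma up_down_0: "T' \<in> trees \<Longrightarrow> up_down 0 T T' = (if (T, T') \<in> G_U then {T'} else {})"
  by (auto simp: up_down_def G_Di_0 G_U_trees)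

lemma down_up_0: "T \<in> trees \<Longrightarrow> down_up 0 T T' = (if (T, T') \<in> G_U then {0} else {})"
  by (auto simp: down_up_def G_Di_0)

lemma card_up_down_empty:
  "finite (up_down j {} T') \<and> card (up_down j {} T') = (if ({}, T') \<in> G_U then 1 else 0)"
proof (cases "({}, T') \<in> G_U")
  case True
  then obtain m where m: "T' = comb m" by (auto simp: G_U_empty_iff)
  have inj: "comb p = comb q \<Longrightarrow> p = q" for p q
  proof (induction p arbitrary: q)
    case 0
    then show ?case by (cases q) auto
  next
    case (Suc p)
    then show ?case by (cases q) auto
  qed
  \<comment> \<open>By \<open>G_Di_comb\<close>, \<open>j\<close> deletions shorten a comb by
    \<open>j\<close>, so only this comb leads back to \<open>comb m\<close>.\<close>
  have "up_down j {} T' = {comb (m + j)}"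
    unfolding up_down_def m by (auto simp: G_U_empty_iff G_Di_comb dest!: inj)
  then show ?thesis using True by simp
next
  case False
  then have "up_down j {} T' = {}"
    by (auto simp: up_down_def G_U_empty_iff G_Di_comb)
  then show ?thesis using False by simp
qed

lemma down_up_empty: "down_up j {} T' = (if ({}, T') \<in> G_U then {0} else {})"
  by (auto simp: down_up_def G_Di_empty)

text \<open>The middle tree is split by its right subtree. If that is empty, the root is deleted and
  \<open>j\<close> deletions remain on the left; otherwise it is a new comb that absorbs all
  deletions.\<close>

lemma up_down_Suc_graft_empty:
  "up_down (Suc j) (graft A {}) T' = (\<lambda>C. graft C {}) ` up_down j A T' \<union>
    (\<Union>(C, D) \<in> {(C, D). T' = graft C D \<and> (A, C) \<in> G_U}. graft C ` up_down (Suc j) {} D)"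
  (is "?L = ?R1 \<union> ?R2")
proof (intro equalityI subsetI)
  fix S assume "S \<in> ?L"
  then obtain C D where S: "S = graft C D" "(A, C) \<in> G_U" "({}, D) \<in> G_U" "(T', S) \<in> G_Di (Suc j)"
    by (auto simp: up_down_def G_U_graft_iff)
  show "S \<in> ?R1 \<union> ?R2"
  proof (cases "D = {}")
    case True
    then show ?thesis using S by (auto simp: up_down_def G_Di_graft_empty)
  next
    case False
    then obtain E where E: "T' = graft C E" "(E, D) \<in> G_Di (Suc j)"
      using S by (auto simp: G_Di_graft)
    then have "D \<in> up_down (Suc j) {} E" using S by (simp add: up_down_def)
    then have "S \<in> ?R2" using S E by (intro UN_I[of "(C, E)"]) simp_all
    then show ?thesis by (rule UnI2)
  qed
next
  fix S assume "S \<in> ?R1 \<union> ?R2"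
  then show "S \<in> ?L"
  proof
    assume "S \<in> ?R1"
    then obtain C where "S = graft C {}" "(A, C) \<in> G_U" "(T', C) \<in> G_Di j"
      by (auto simp: up_down_def)
    then show ?thesis by (simp add: up_down_def G_Di_graft_empty G_U_empty_right)
  next
    assume "S \<in> ?R2"
    then obtain C D E where S: "T' = graft C D" "(A, C) \<in> G_U" "S = graft C E"
      "({}, E) \<in> G_U" "(D, E) \<in> G_Di (Suc j)"
      by (auto simp: up_down_def)
    \<comment> \<open>The empty tree admits no positive number of deletions.\<close>
    then have "E \<noteq> {}" by (auto simp: G_Di_empty)
    then show ?thesis using S by (simp add: up_down_def G_Di_graft G_U_trees[OF S(2)])
  qed
qed

lemma down_up_Suc_graft_empty:
  assumes "A \<in> trees"
  shows "down_up (Suc j) (graft A {}) T' =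
    (if (graft A {}, T') \<in> G_U then {0} else {}) \<union> Suc ` down_up j A T'"
proof -
  have "k \<in> down_up (Suc j) (graft A {}) T' \<longleftrightarrow>
      k \<in> (if (graft A {}, T') \<in> G_U then {0} else {}) \<union> Suc ` down_up j A T'" for k
    using assms by (cases k) (auto simp: down_up_def G_Di_0 G_Di_graft_empty)
  then show ?thesis by blast
qed

lemma up_down_graft_iff:
  assumes "B \<noteq> {}"
  shows "S \<in> up_down j (graft A B) T' \<longleftrightarrow>
    (\<exists>C D E. S = graft C E \<and> T' = graft C D \<and> (A, C) \<in> G_U \<and> E \<in> up_down j B D)"
proof -
  have "(T', graft C E) \<in> G_Di j \<longleftrightarrow> (\<exists>D. T' = graft C D \<and> (D, E) \<in> G_Di j)"
    if "(A, C) \<in> G_U" "(B, E) \<in> G_U" for C E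
  proof -
    have "E \<noteq> {}" using that(2) assms by (metis G_U_empty_right)
    then show ?thesis using G_U_trees[OF that(1)] by (simp add: G_Di_graft)
  qed
  then show ?thesis unfolding up_down_def G_U_graft_iff mem_Collect_eq by blast
qed

lemma up_down_graft:
  assumes "B \<noteq> {}"
  shows "up_down j (graft A B) {} = {}"
    "up_down j (graft A B) (graft C D) = (if (A, C) \<in> G_U then graft C ` up_down j B D else {})"
proof -
  show "up_down j (graft A B) {} = {}"
    by (rule set_eqI) (simp add: up_down_graft_iff[OF assms])
  show "up_down j (graft A B) (graft C D) = (if (A, C) \<in> G_U then graft C ` up_down j B D else {})"
    by (rule set_eqI) (auto simp: up_down_graft_iff[OF assms])
qed

lemma down_up_graft:
  assumes "A \<in> trees" "B \<noteq> {}"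
  shows "down_up j (graft A B) {} = {}"
    "down_up j (graft A B) (graft C D) = (if (A, C) \<in> G_U then down_up j B D else {})"
proof -
  have "(\<exists>S. (S, graft A B) \<in> G_Di k \<and> (S, T') \<in> G_U) \<longleftrightarrow>
      (\<exists>E. (E, B) \<in> G_Di k \<and> (graft A E, T') \<in> G_U)" for k T'
    using assms by (simp add: G_Di_graft) blast
  then show "down_up j (graft A B) {} = {}"
    "down_up j (graft A B) (graft C D) = (if (A, C) \<in> G_U then down_up j B D else {})"
    by (simp_all add: down_up_def)
qed

text \<open>The commutation relation, coefficient by coefficient. When \<open>B\<close> is empty and
  \<open>j\<close> positive, middle trees with a new right comb match \<open>k = 0\<close>, and
  those whose root is deleted match positive \<open>k\<close> by induction on \<open>A\<close>. When
  \<open>B\<close> is nonempty, both sides reduce to \<open>B\<close>.\<close>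

lemma card_up_down:
  assumes "T \<in> trees" "T' \<in> trees"
  shows "finite (up_down j T T') \<and> card (up_down j T T') = card (down_up j T T')"
  using assms
proof (induction arbitrary: j T' rule: trees_induct)
  case empty
  then show ?case using card_up_down_empty[of j T'] by (simp add: down_up_empty)
next
  case (graft A B)
  show ?case
  proof (cases "B = {}")
    case B: True
    show ?thesis
    proof (cases j)
      case 0
      then show ?thesis using graft by (simp add: up_down_0 down_up_0)
    next
      case (Suc i)
      let ?R1 = "(\<lambda>C. graft C {}) ` up_down i A T'"
      let ?R2 = "\<Union>(C, D) \<in> {(C, D). T' = graft C D \<and> (A, C) \<in> G_U}. graft C ` up_down (Suc i) {} D"
      have R1: "finite ?R1 \<and> card ?R1 = card (down_up i A T')"
        using graft by (subst card_image) (auto simp: inj_on_def)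
      \<comment> \<open>A nonempty \<open>T'\<close> determines \<open>C\<close> and
        \<open>D\<close>, and \<open>card_up_down_empty\<close> leaves at most one comb above
        \<open>D\<close>.\<close>
      have R2: "finite ?R2 \<and> card ?R2 = (if (graft A {}, T') \<in> G_U then 1 else 0)"
        using graft.prems
      proof (cases rule: tree_cases)
        case (2 C D)
        show ?thesis
        proof (cases "(A, C) \<in> G_U")
          case True
          then have "?R2 = graft C ` up_down (Suc i) {} D" using 2 by auto
          then show ?thesis
            using 2 True card_up_down_empty[of "Suc i" D] by (simp add: card_image inj_on_def)
        next
          case False
          then have "{(C, D). T' = graft C D \<and> (A, C) \<in> G_U} = {}" using 2 by auto
          then show ?thesis using 2 False by (simp only:) simp
        qed
      qed simp
      \<comment> \<open>The right subtree is empty in \<open>?R1\<close>, but in \<open>?R2\<close>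
        it admits \<open>Suc i\<close> deletions.\<close>
      have "?R1 \<inter> ?R2 = {}"
        by (auto simp: up_down_def G_Di_empty)
      then have "card (up_down j (graft A B) T') = card ?R1 + card ?R2"
        using R1 R2 unfolding B Suc up_down_Suc_graft_empty by (intro card_Un_disjoint) auto
      moreover have "finite (up_down j (graft A B) T')"
        using R1 R2 unfolding B Suc up_down_Suc_graft_empty by (intro finite_UnI) auto
      moreover have "card (down_up j (graft A B) T') =
          (if (graft A {}, T') \<in> G_U then 1 else 0) + card (down_up i A T')"
        unfolding B Suc down_up_Suc_graft_empty[OF graft.hyps(1)]
        by (subst card_Un_disjoint) (auto simp: finite_down_up card_image)
      ultimately show ?thesis using R1 R2 by simp
    qed
  next
    case False
    from graft.prems show ?thesis
    proof (cases rule: tree_cases)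
      case 1
      then show ?thesis using False graft by (simp add: up_down_graft down_up_graft)
    next
      case (2 C D)
      then show ?thesis using False graft
        by (simp add: up_down_graft down_up_graft card_image inj_on_def)
    qed
  qed
qed

lemma card_le_of_G_U: "(S, T) \<in> G_U \<Longrightarrow> card S \<le> card T"
  by (simp add: G_U_iff card_mono finite_tree)

theorem lemma4p11:
  fixes T T' :: "word set" and i j :: nat
  assumes "T \<in> trees" and "T' \<in> trees"
  shows "\<exists>f. bij_betw f (N_set i j T T') (S_tilde j i T T')"
proof -
  let ?S = "S_tilde j i T T'"
  \<comment> \<open>The index \<open>k\<close> fixes the number \<open>j - k\<close> of deletions
    from \<open>T\<close>, hence the middle tree.\<close>
  have inj: "inj_on fst ?S"
    by (auto simp: inj_on_def S_tilde_def S_set_def dest: G_Di_unique)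
  have N: "N_set i j T T' = (\<lambda>S. ((T, S), (T', S))) ` {S \<in> up_down j T T'. card T + i = card S}"
    by (auto simp: N_set_def up_down_def G_Ui_def dest: G_U_trees)
  have fst_S: "fst ` ?S = {k. k \<le> min i j \<and> (\<exists>S. (S, T) \<in> G_Di (j - k) \<and> (S, T') \<in> G_Ui (i - k))}"
    by (force simp: S_tilde_def S_set_def dest: G_Di_tree_card)
  have "finite (fst ` ?S)" unfolding fst_S by simp
  then have finS: "finite ?S" using inj by (rule finite_imageD)
  show ?thesis
  proof (cases "card T + i = card T' + j")
    case True
    then have "{S \<in> up_down j T T'. card T + i = card S} = up_down j T T'"
      by (auto simp: up_down_def dest: G_Di_tree_card)
    then have "card (N_set i j T T') = card (up_down j T T')"
      unfolding N by (simp add: card_image inj_on_def)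
    moreover have "finite (N_set i j T T')"
      using card_up_down[OF assms] unfolding N by simp
    \<comment> \<open>The reflection exchanges deletions omitted and deletions performed.\<close>
    moreover have "fst ` ?S = (\<lambda>k. j - k) ` down_up j T T'"
    proof (intro equalityI subsetI)
      fix k assume "k \<in> fst ` ?S"
      then have "k = j - (j - k)" "j - k \<in> down_up j T T'"
        unfolding fst_S by (auto simp: down_up_def G_Ui_def)
      then show "k \<in> (\<lambda>k. j - k) ` down_up j T T'" by blast
    next
      fix k assume "k \<in> (\<lambda>k. j - k) ` down_up j T T'"
      then obtain l S where l: "l \<le> j" "k = j - l" "(S, T) \<in> G_Di l" "(S, T') \<in> G_U"
        by (auto simp: down_up_def)
      \<comment> \<open>The bound \<open>k \<le> i\<close> comes from
        \<open>card S \<le> card T'\<close> and the balance of sizes.\<close>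
      with True show "k \<in> fst ` ?S"
        unfolding fst_S using card_le_of_G_U[OF l(4)] G_Di_tree_card[OF l(3)]
        by (auto simp: G_Ui_def intro!: exI[of _ S])
    qed
    moreover have "inj_on (\<lambda>k. j - k) (down_up j T T')"
      by (auto simp: inj_on_def down_up_def)
    ultimately have "card (N_set i j T T') = card ?S"
      using card_up_down[OF assms, of j] card_image[OF inj] by (simp add: card_image)
    with \<open>finite (N_set i j T T')\<close> finS show ?thesis by (rule finite_same_card_bij)
  next
    case False
    \<comment> \<open>Either order of the two edges would force
      \<open>card T + i = card T' + j\<close>, so both sides are empty.\<close>
    then have "N_set i j T T' = {}"
      unfolding N by (auto simp: up_down_def dest: G_Di_tree_card)
    moreover have "fst ` ?S = {}"
      using False unfolding fst_S by (auto simp: G_Ui_def dest!: G_Di_tree_card)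
    ultimately show ?thesis by (simp add: bij_betw_def)
  qed
qed

end
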